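(* Let $q$ be a square prime power and let $a\in \mathrm{GF}(q^2)\setminus\{0\}$. Let $\Gamma_a$ denote the algebraic plane curve of affine equation $$\mathrm{Tr}(y+ax^{\sqrt{q}})=\mathrm{N}(x).$$ Then the set of projective points of $\Gamma_a$ in $\mathrm{PG}(2,q^2)$ has size $q^3+1$ and is regular of pointed type $$[\,q;\ q-2\sqrt{q}+1,\ q-\sqrt{q}+1,\ q+1,\ q+\sqrt{q}+1\,].$$
   Context: $\mathrm{Tr}$ and $\mathrm{N}$ denote the functions $\mathrm{GF}(q^2)\to\mathrm{GF}(q)$, $x\mapsto x+x^q$ and $x\mapsto x^{q+1}$, respectively; in the equation of the curve, $\mathrm{Tr}(u)$ stands for $u+u^q$ and $\mathrm{N}(u)$ for $u^{q+1}$. The set of projective points of the curve is the set of all $\mathrm{GF}(q^2)$-rational points in $\mathrm{PG}(2,q^2)$ of its projective closure (its affine $\mathrm{GF}(q^2)$-rational points together with its points at infinity). A line is a $k$-secant of a point set $X$ if it meets $X$ in exactly $k$ points. Definition (applied with $Q=q^2$). A point set $X$ of $\mathrm{PG}(2,Q)$ is regular of pointed type $[t;m_1,m_2,\ldots,m_h]$, where $t>0$, if there are a distinguished point $P_0\in X$ and a line $\ell_0$ with $\ell_0\cap X=\{P_0\}$ such that: (i) every line not through $P_0$ is an $m_i$-secant of $X$ for some $i\in\{1,\ldots,h\}$; (ii) for each $i$, the number of $m_i$-secants of $X$ incident with $P$ is the same for each $P\in\ell_0\setminus\{P_0\}$; (iii) all lines incident with $P_0$ other than $\ell_0$ are $(t+1)$-secants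 of $X$. (It is not required that each of the $m_i$ actually occurs.) *)

theory Defs
  imports
    "HOL-Analysis.Cartesian_Space"
    "HOL-Computational_Algebra.Polynomial"
    "HOL-Number_Theory.Prime_Powers"
begin

text \<open>
  Points and lines of \<open>PG(2,F)\<close> are the subspaces of \<open>F^3\<close> of vector space dimension 1 and 2;
  incidence is inclusion. The affine point \<open>(x,y)\<close> is the span of \<open>(x,y,1)\<close>, so the line at
  infinity is \<open>z = 0\<close>.
\<close>

definition pg_points :: "('a::field ^ 3) set set" where
  "pg_points = {P. vec.subspace P \<and> vec.dim P = 1}"

definition pg_lines :: "('a::field ^ 3) set set" where
  "pg_lines = {l. vec.subspace l \<and> vec.dim l = 2}"

definition points_on :: "('a::field ^ 3) set set \<Rightarrow> ('a ^ 3) set \<Rightarrow> ('a ^ 3) set set" where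
  "points_on X l = {P \<in> X. P \<subseteq> l}"

text \<open>The ground field is finite, so that \<^const>\<open>card\<close> really counts points.\<close>

definition secant :: "('a::{finite,field} ^ 3) set set \<Rightarrow> nat \<Rightarrow> ('a ^ 3) set \<Rightarrow> bool" where
  "secant X k l \<longleftrightarrow> l \<in> pg_lines \<and> card (points_on X l) = k"

definition regular_pointed_type ::
    "nat \<Rightarrow> nat list \<Rightarrow> ('a::{finite,field} ^ 3) set set \<Rightarrow> bool" where
  "regular_pointed_type t ms X \<longleftrightarrow>
     X \<subseteq> pg_points \<and> t > 0 \<and>
     (\<exists>P0 \<in> X. \<exists>l0 \<in> pg_lines. points_on X l0 = {P0} \<and>
        (\<forall>l \<in> pg_lines. \<not> P0 \<subseteq> l \<longrightarrow> (\<exists>m \<in> set ms. secant X m l)) \<and>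
        (\<forall>m \<in> set ms. \<exists>n. \<forall>P \<in> points_on pg_points l0 - {P0}.
            card {l. secant X m l \<and> P \<subseteq> l} = n) \<and>
        (\<forall>l \<in> pg_lines. P0 \<subseteq> l \<and> l \<noteq> l0 \<longrightarrow> secant X (t + 1) l))"

text \<open>
  A polynomial \<open>f(x,y)\<close> is encoded as a polynomial in \<open>y\<close> whose coefficients are polynomials
  in \<open>x\<close>: the coefficient of \<open>x^i y^j\<close> is \<open>coeff (coeff f j) i\<close>.
\<close>

definition monomials2 :: "'a::zero poly poly \<Rightarrow> (nat \<times> nat) set" where
  "monomials2 f = {(i, j). coeff (coeff f j) i \<noteq> 0}"

definition total_degree2 :: "'a::zero poly poly \<Rightarrow> nat" where
  "total_degree2 f = Max (insert 0 ((\<lambda>(i, j). i + j) ` monomials2 f))"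

text \<open>The value at \<open>v = (x,y,z)\<close> of the homogenization \<open>z^d f(x/z, y/z)\<close>, \<open>d\<close> the total degree.\<close>

definition homogenization2 :: "'a::field poly poly \<Rightarrow> 'a ^ 3 \<Rightarrow> 'a" where
  "homogenization2 f v =
     (\<Sum>(i, j) \<in> monomials2 f.
        coeff (coeff f j) i * (v $ 1) ^ i * (v $ 2) ^ j * (v $ 3) ^ (total_degree2 f - (i + j)))"

text \<open>The rational points of the projective closure of the affine curve \<open>f(x,y) = 0\<close>.\<close>

definition projective_curve_points :: "'a::field poly poly \<Rightarrow> ('a ^ 3) set set" where
  "projective_curve_points f = {P \<in> pg_points. \<forall>v \<in> P - {0}. homogenization2 f v = 0}"

definition poly_x :: "'a::comm_semiring_1 poly poly" where
  "poly_x = [:[:0, 1:]:]"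

definition poly_y :: "'a::comm_semiring_1 poly poly" where
  "poly_y = [:0, 1:]"

text \<open>
  The trace and norm from \<open>GF(q^2)\<close> to \<open>GF(q)\<close>, as expressions in an arbitrary commutative
  ring, because the equation of the curve applies them to polynomials.
\<close>

definition Tr :: "nat \<Rightarrow> 'r::comm_ring_1 \<Rightarrow> 'r" where
  "Tr q u = u + u ^ q"

definition N :: "nat \<Rightarrow> 'r::comm_ring_1 \<Rightarrow> 'r" where
  "N q u = u ^ (q + 1)"

text \<open>The parameter \<open>s\<close> is the square root of \<open>q\<close>.\<close>

definition Gamma_poly :: "nat \<Rightarrow> nat \<Rightarrow> 'a::field \<Rightarrow> 'a poly poly" where
  "Gamma_poly q s a = Tr q (poly_y + [:[:a:]:] * poly_x ^ s) - N q poly_x"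

end

theory Submission
  imports Defs
begin

text \<open>
  Write \<open>F = GF(q^2)\<close>, \<open>L = GF(q)\<close>, \<open>K = GF(s)\<close>. For \<open>s \<ge> 2\<close> the term \<open>a^q x^(s q)\<close> of the
  equation has the largest degree, so the curve meets the line at infinity only in \<open>(0 : 1 : 0)\<close>, the
  common point of the vertical lines. Each vertical line prescribes \<open>Tr y\<close>, which leaves \<open>q\<close> affine
  points on it. This gives the size \<open>q^3 + 1\<close> and all lines through the distinguished point.

  Put \<open>Q(x) = N(x) - Tr(a x^s)\<close>. The line \<open>y = m x + b\<close> meets the curve where
  \<open>Q(x) = Tr(m x) + Tr(b)\<close>. Since \<open>N(x + m^q) = N(x) + Tr(m x) + N(m)\<close>, the substitution
  \<open>x \<mapsto> x + m^q\<close> removes the slope and turns this into \<open>Q(x) = Tr(b')\<close>, where \<open>b'\<close> is a translate of \<open>b\<close>.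
  Hence the secants through any two points at infinity other than the distinguished one are
  distributed alike (\<open>card_line_count_slope_invariant\<close>), and what is left is the size of
  \<open>{x. Q(x) = e}\<close> for \<open>e \<in> L\<close>.

  Over \<open>K\<close>, where \<open>F\<close> has dimension four and \<open>L\<close> dimension two, \<open>Q(x) = e\<close> is an intersection of two
  affine quadrics. The members of the pencil which they span are \<open>Tr_s(l (Q(x) - e)) = 0\<close> with
  \<open>l \<in> L\<close> nonzero and \<open>Tr_s(u) = u + u^s\<close>. Because \<open>x \<mapsto> x^s\<close> is additive, a translation of \<open>x\<close>
  absorbs the linear part \<open>Tr(a x^s)\<close>, and the member becomes \<open>Tr_s(l N(x)) = k(l)\<close>, whose points can
  be counted from the fibres of the norm and of the trace: there are \<open>s^3 + s\<close> of them, or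
  \<open>s^2\<close> fewer if \<open>k(l) = 0\<close>. The latter happens exactly when \<open>t = l^(s - 1)\<close> is a root of the cubic
  \<open>N(a)^s t^3 + e^s t^2 + e t + N(a)\<close> (\<open>Tr_s_eq_0_iff_cubic_root\<close>).
  Every \<open>x\<close> with \<open>Q(x) = e\<close> lies on all members and every other \<open>x\<close> on a fixed number of
  them, so counting incidences twice yields \<open>q + s + 1 - z s\<close> solutions, where \<open>z \<le> 3\<close> is the number
  of roots of the cubic among the \<open>(s + 1)\<close>-st roots of unity (\<open>card_Q_fibre\<close>). The four
  intersection numbers correspond to \<open>z = 3, 2, 1, 0\<close>.
\<close>

section \<open>Fibres of extremal size\<close>

lemma card_eq_sum_card_fibres:
  assumes "finite A" "finite B" "f ` A \<subseteq> B"
  shows "card A = (\<Sum>b\<in>B. card {x \<in> A. f x = b})"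
proof -
  have "(\<Sum>b\<in>B. card {x \<in> A. f x = b}) = card (\<Union>b\<in>B. {x \<in> A. f x = b})"
    by (rule card_UN_disjoint[symmetric]) (use assms in auto)
  also have "(\<Union>b\<in>B. {x \<in> A. f x = b}) = A"
    using assms by auto
  finally show ?thesis ..
qed

text \<open>
  A map with fibres of size at most \<open>m\<close> into a set of at most \<open>n\<close> elements, on a domain of \<open>m n\<close>
  elements, leaves no slack. The polynomials that define traces, norms and powers on finite fields
  bound their fibres by their degrees, and these degrees multiply to the size of the domain; so
  the exact sizes of all the fibres, and of the subfields, come out of this pigeonhole argument.
\<close>

lemma extremal_fibres:
  assumes "finite A" "finite B" "f ` A \<subseteq> B"
    and le_m: "\<And>b. b \<in> B \<Longrightarrow> card {x \<in> A. f x = b} \<le> m"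
    and le_n: "card B \<le> n" and card_A: "card A = m * n" and "0 < m"
  shows "card B = n" and "\<And>b. b \<in> B \<Longrightarrow> card {x \<in> A. f x = b} = m"
proof -
  let ?g = "\<lambda>b. card {x \<in> A. f x = b}"
  have sum: "(\<Sum>b\<in>B. ?g b) = m * n"
    using card_eq_sum_card_fibres[OF assms(1-3)] card_A by simp
  have "(\<Sum>b\<in>B. ?g b) \<le> card B * m"
    using sum_bounded_above[of B ?g m] le_m by simp
  hence "n * m \<le> card B * m"
    using sum by (simp add: mult.commute)
  thus eq: "card B = n"
    using le_n \<open>0 < m\<close> by simp
  show "?g b = m" if "b \<in> B" for b
  proof (rule ccontr)
    assume "?g b \<noteq> m"
    hence "(\<Sum>b\<in>B. ?g b) < (\<Sum>b\<in>B. m)"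
      using that le_m assms(2) by (intro sum_strict_mono_ex1) (auto intro!: bexI[of _ b] le_neq_implies_less)
    thus False
      using sum eq by (simp add: mult.commute)
  qed
qed

text \<open>
  Completing the square, moving the slope of a line to zero and comparing two families of parallel
  lines are all done by translations.
\<close>

lemma card_Collect_translate:
  fixes c :: "'a::ab_group_add"
  shows "card {x. P (x + c)} = card {x. P x}"
proof -
  have "bij_betw (\<lambda>x. x + c) {x. P (x + c)} {x. P x}"
    by (rule bij_betw_byWitness[where f' = "\<lambda>x. x - c"]) auto
  thus ?thesis
    by (rule bij_betw_same_card)
qed

lemma card_power_eq_poly_le:
  fixes r :: "'a::field poly"
  assumes "degree r < n"
  shows "card {x. x ^ n = poly r x} \<le> n"
proof -
  let ?p = "monom 1 n - r"
  have "degree ?p = n"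
    using assms by (metis add_uminus_conv_diff degree_add_eq_left degree_minus degree_monom_eq one_neq_zero)
  moreover have "?p \<noteq> 0"
    using calculation assms by auto
  ultimately have "card {x. poly ?p x = 0} \<le> n"
    by (metis card_poly_roots_bound)
  thus ?thesis
    by (simp add: poly_monom)
qed

text \<open>
  Multiplication by a nonzero \<open>x\<close> permutes the nonzero elements and hence fixes their product.
\<close>

lemma power_card_UNIV_eq_self:
  fixes x :: "'a::{finite,field}"
  shows "x ^ CARD('a) = x"
proof (cases "x = 0")
  case False
  let ?U = "UNIV - {0 :: 'a}"
  have "(\<Prod>y\<in>?U. x * y) = \<Prod>?U"
    by (rule prod.reindex_bij_witness[of _ "\<lambda>y. y / x" "\<lambda>y. x * y"]) (use False in auto)
  hence "x ^ card ?U * \<Prod>?U = \<Prod>?U"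
    by (simp add: prod.distrib)
  moreover have "\<Prod>?U \<noteq> 0"
    by simp
  ultimately have "x ^ card ?U = 1"
    by (metis mult_cancel_right1 mult.commute)
  thus ?thesis
    by (metis (no_types) UNIV_I card.remove finite_class.finite_UNIV mult.right_neutral power_Suc)
qed (simp add: zero_power)


section \<open>Trace and norm for the field extensions of degree two\<close>

text \<open>
  The type \<open>'a\<close> is \<open>GF(q^2) = GF(s^4)\<close>. The intermediate fields appear below as the sets \<open>L\<close> and \<open>K\<close>
  of fixed points of the powers of the Frobenius map, because they have no types of their own.
\<close>

locale gf_biquadratic =
  fixes q s :: nat and field_type :: "'a::{finite,field} itself"
  assumes primepow_q: "primepow q" and q_eq: "q = s ^ 2" and card_F: "CARD('a) = q ^ 2"
begin

text \<open>
  This is what makes \<open>x \<mapsto> x^s\<close> additive.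
\<close>

lemma s_eq_CHAR_power: "\<exists>k. s = CHAR('a) ^ k"
proof -
  obtain p k where p: "prime p" "q = p ^ k"
    using primepow_q by (auto simp: primepow_def)
  have pr: "prime CHAR('a)"
    by (rule prime_CHAR_semidom) (simp add: finite_imp_CHAR_pos)
  \<comment> \<open>Translation by one permutes the field, so summing all its elements gives \<open>|F| = 0\<close> in it.\<close>
  have "(\<Sum>x\<in>UNIV. x + (1::'a)) = (\<Sum>x\<in>UNIV. x)"
    by (rule sum.reindex_bij_witness[of _ "\<lambda>x. x - 1" "\<lambda>x. x + 1"]) auto
  hence "of_nat (CARD('a)) = (0::'a)"
    by (simp add: sum.distrib)
  hence "CHAR('a) dvd p ^ (k * 2)"
    unfolding of_nat_eq_0_iff_char_dvd card_F p(2) by (simp only: power_mult)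
  hence "CHAR('a) = p"
    using p(1) pr by (meson prime_dvd_power primes_dvd_imp_eq)
  moreover have "s dvd p ^ k"
    using p(2) q_eq by (metis dvd_triv_left power2_eq_square)
  ultimately show ?thesis
    using p(1) divides_primepow_nat by blast
qed

lemma s_ge_2: "2 \<le> s"
  using primepow_gt_Suc_0[OF primepow_q] q_eq
  by (cases "s = 0 \<or> s = 1") auto

lemma two_s_le_q: "2 * s \<le> q"
  using s_ge_2 by (simp add: q_eq power2_eq_square)

text \<open>
  Additivity holds in every ring of the same characteristic; it is needed both for elements of the
  field and for the polynomials that make up the equation of the curve.
\<close>

lemma power_s_add:
  fixes x y :: "'b::comm_semiring_1"
  assumes "CHAR('b) = CHAR('a)"
  shows "(x + y) ^ s = x ^ s + y ^ s"
proof -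
  have "prime CHAR('a)"
    by (rule prime_CHAR_semidom) (simp add: finite_imp_CHAR_pos)
  thus ?thesis
    using s_eq_CHAR_power assms by (metis freshmans_dream')
qed

lemma power_q_eq: "(x :: 'b::monoid_mult) ^ q = (x ^ s) ^ s"
  by (simp only: q_eq power2_eq_square power_mult)

lemma power_q_add:
  fixes x y :: "'b::comm_semiring_1"
  assumes "CHAR('b) = CHAR('a)"
  shows "(x + y) ^ q = x ^ q + y ^ q"
  by (simp add: power_q_eq power_s_add assms)

lemma power_s_diff: "(x - y :: 'a) ^ s = x ^ s - y ^ s"
  using power_s_add[of "x - y" y] by (simp add: eq_diff_eq)

lemma power_q_diff: "(x - y :: 'a) ^ q = x ^ q - y ^ q"
  by (simp add: power_q_eq power_s_diff)

lemma power_q_power_q: "((x::'a) ^ q) ^ q = x"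
  using power_card_UNIV_eq_self[of x] by (simp add: card_F power2_eq_square power_mult)

lemmas frobenius = power_s_add[OF refl] power_q_add[OF refl] power_s_diff power_q_diff
  power_q_power_q power_mult_distrib

lemma zero_power_sq: "(0::'a) ^ s = 0" "(0::'a) ^ q = 0"
  using s_ge_2 two_s_le_q by auto

definition L :: "'a set" where "L = {x. x ^ q = x}"

definition K :: "'a set" where "K = {x. x ^ s = x}"

lemma Tr_q_in_L: "Tr q x \<in> L"
  by (simp add: Tr_def L_def frobenius)

lemma N_in_L: "N q x \<in> L"
  by (simp add: N_def L_def frobenius power_add mult.commute)

lemma Tr_s_in_K: "x \<in> L \<Longrightarrow> Tr s x \<in> K"
  by (simp add: Tr_def L_def K_def frobenius power_q_eq)

lemma card_Tr_fibre_le: "card {x::'a. Tr n x = b} \<le> n" if "2 \<le> n"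
proof -
  have "{x. Tr n x = b} = {x. x ^ n = poly [:b, -1:] x}"
    by (auto simp: Tr_def algebra_simps)
  thus ?thesis
    using card_power_eq_poly_le[of "[:b, -1:]" n] that by simp
qed

lemma card_fixed_points_le: "card {x::'a. x ^ n = x} \<le> n" if "2 \<le> n"
  using card_power_eq_poly_le[of "[:0, 1::'a:]" n] that by simp

text \<open>
  The trace maps \<open>q^2\<close> elements into the at most \<open>q\<close> roots of \<open>X^q - X\<close>, and it is itself given by a
  polynomial of degree \<open>q\<close>.
\<close>

lemma card_L: "card L = q"
  and card_Tr_q_fibre: "b \<in> L \<Longrightarrow> card {x. Tr q x = b} = q"
proof -
  have "2 \<le> q" using two_s_le_q s_ge_2 by simp
  moreover have "card L \<le> q"
    using card_fixed_points_le[of q] \<open>2 \<le> q\<close> by (simp add: L_def)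
  ultimately have "card L = q \<and> (\<forall>b\<in>L. card {x \<in> UNIV. Tr q x = b} = q)"
    using extremal_fibres[of "UNIV :: 'a set" L "Tr q" q q] Tr_q_in_L card_Tr_fibre_le[of q]
    by (auto simp: card_F power2_eq_square image_subset_iff)
  thus "card L = q" "b \<in> L \<Longrightarrow> card {x. Tr q x = b} = q"
    by auto
qed

lemma card_Tr_s_fibre:
  assumes "c \<in> K"
  shows "card {u \<in> L. Tr s u = c} = s"
proof -
  have "card K \<le> s"
    using card_fixed_points_le[of s] s_ge_2 by (simp add: K_def)
  moreover have "card {u \<in> L. Tr s u = b} \<le> s" for b
    using card_Tr_fibre_le[of s b] s_ge_2 card_mono[of "{u. Tr s u = b}" "{u \<in> L. Tr s u = b}"] by force
  ultimately show ?thesis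
    using extremal_fibres(2)[of L K "Tr s" s s c] Tr_s_in_K s_ge_2 card_L assms
    by (auto simp: q_eq power2_eq_square image_subset_iff)
qed

lemma zero_in: "0 \<in> L" "0 \<in> K"
  by (auto simp: L_def K_def zero_power_sq)

lemma card_L_nonzero: "card (L - {0}) = q - 1"
  using zero_in card_L by simp

text \<open>
  The norm maps \<open>q^2 - 1 = (q + 1) (q - 1)\<close> nonzero elements into the \<open>q - 1\<close> nonzero elements of
  \<open>L\<close>, and it is the power \<open>q + 1\<close>.
\<close>

lemma card_N_fibre:
  assumes "u \<in> L" "u \<noteq> 0"
  shows "card {x. N q x = u} = q + 1"
proof -
  let ?A = "UNIV - {0::'a}" and ?B = "L - {0}"
  have "card {x \<in> ?A. N q x = b} \<le> q + 1" for b
    using card_power_eq_poly_le[of "[:b:]" "q + 1"] card_mono[of "{x. x ^ (q+1) = b}" "{x \<in> ?A. N q x = b}"]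
    by (force simp: N_def)
  moreover have "card ?A = (q + 1) * (q - 1)"
    using card_F by (simp add: card_Diff_singleton power2_eq_square algebra_simps)
  moreover have "N q ` ?A \<subseteq> ?B"
    using N_in_L by (auto simp: N_def)
  ultimately have "card {x \<in> ?A. N q x = u} = q + 1"
    using extremal_fibres(2)[of ?A ?B "N q" "q + 1" "q - 1"] card_L_nonzero assms by simp
  moreover have "{x \<in> ?A. N q x = u} = {x. N q x = u}"
    using assms(2) by (auto simp: N_def)
  ultimately show ?thesis by simp
qed

lemma power_s_minus_1:
  assumes "u \<in> L" "u \<noteq> 0"
  shows "(u ^ (s - 1)) ^ (s + 1) = 1" and "u ^ s = u * u ^ (s - 1)"
proof -
  show *: "u ^ s = u * u ^ (s - 1)"
    using s_ge_2 by (simp flip: power_Suc)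
  have "(s - 1) * (s + 1) + 1 = q"
    using s_ge_2 by (simp add: q_eq power2_eq_square algebra_simps)
  hence "(u ^ (s - 1)) ^ (s + 1) * u = u ^ q"
    by (metis power_mult power_add power_one_right)
  thus "(u ^ (s - 1)) ^ (s + 1) = 1"
    using assms by (simp add: L_def)
qed

text \<open>
  The fibres are the one-dimensional \<open>K\<close>-subspaces of \<open>L\<close> without zero. Thus the \<open>(s + 1)\<close>-st roots of
  unity parametrize the members of a pencil of quadrics over \<open>K\<close>.
\<close>

lemma card_power_s_minus_1_fibre:
  assumes "t ^ (s + 1) = 1"
  shows "card {u \<in> L - {0}. u ^ (s - 1) = t} = s - 1"
proof -
  let ?A = "L - {0}" and ?B = "{t::'a. t ^ (s + 1) = 1}"
  have "card {x \<in> ?A. x ^ (s - 1) = b} \<le> s - 1" for b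
    using card_power_eq_poly_le[of "[:b:]" "s - 1"] s_ge_2
      card_mono[of "{x. x ^ (s - 1) = b}" "{x \<in> ?A. x ^ (s - 1) = b}"] by force
  moreover have "card ?B \<le> s + 1"
    using card_power_eq_poly_le[of "[:1:]" "s + 1"] by simp
  moreover have "card ?A = (s - 1) * (s + 1)"
    using card_L_nonzero s_ge_2 by (simp add: q_eq power2_eq_square algebra_simps)
  moreover have "(\<lambda>x. x ^ (s - 1)) ` ?A \<subseteq> ?B"
    using power_s_minus_1(1) by auto
  ultimately show ?thesis
    using extremal_fibres(2)[of ?A ?B "\<lambda>x. x ^ (s - 1)" "s - 1" "s + 1"] assms s_ge_2 by simp
qed

end

section \<open>Rational points in the pencil of quadrics over the small field\<close>

context gf_biquadratic
begin

text \<open>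
  Nonzero scalars \<open>l \<in> L\<close> stand for the members \<open>Tr s (l * (Q a x - e)) = 0\<close> of the pencil; two scalars
  that differ by a factor in \<open>K\<close> give the same member.
\<close>

lemma L_closed:
  assumes "u \<in> L" "v \<in> L"
  shows "u * v \<in> L" "u / v \<in> L" "u + v \<in> L" "u - v \<in> L"
  using assms by (simp_all add: L_def frobenius power_divide)

lemma L_power: "u \<in> L \<Longrightarrow> u ^ n \<in> L"
  by (induction n) (simp_all add: L_def power_mult_distrib)

lemma card_Tr_s_mult_fibre:
  assumes "l \<in> L" "l \<noteq> 0" "c \<in> K"
  shows "card {u \<in> L. Tr s (l * u) = c} = s"
proof -
  have "bij_betw (\<lambda>u. l * u) {u \<in> L. Tr s (l * u) = c} {w \<in> L. Tr s w = c}"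
  proof (rule bij_betw_byWitness[where f' = "\<lambda>w. w / l"])
    show "(*) l ` {u \<in> L. Tr s (l * u) = c} \<subseteq> {w \<in> L. Tr s w = c}"
      using L_closed(1)[OF assms(1)] by blast
    show "(\<lambda>w. w / l) ` {w \<in> L. Tr s w = c} \<subseteq> {u \<in> L. Tr s (l * u) = c}"
      using assms(2) L_closed(2)[OF _ assms(1)] by (simp add: image_subset_iff)
  qed (use assms(2) in simp_all)
  thus ?thesis
    using card_Tr_s_fibre[OF assms(3)] bij_betw_same_card by fastforce
qed

text \<open>
  The condition \<open>Tr s (l * u) = c\<close> leaves \<open>s\<close> values \<open>u\<close> for the norm, each taken \<open>q + 1\<close> times. The only
  exception is \<open>u = 0\<close>, which is taken once; it is among the admissible values exactly for \<open>c = 0\<close>,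
  and this costs \<open>q = s^2\<close> solutions.
\<close>

lemma card_Tr_s_norm_fibre:
  assumes l: "l \<in> L" "l \<noteq> 0" and c: "c \<in> K"
  shows "card {x. Tr s (l * N q x) = c} + (if c = 0 then s ^ 2 else 0) = s ^ 3 + s"
proof -
  let ?X = "{x. Tr s (l * N q x) = c}" and ?U = "{u \<in> L. Tr s (l * u) = c}"
  have card_U: "card ?U = s"
    using card_Tr_s_mult_fibre[OF l c] .
  have fibre: "card {x \<in> ?X. N q x = u} = (if u = 0 then 1 else q + 1)" if "u \<in> ?U" for u
  proof -
    have "{x \<in> ?X. N q x = u} = {x. N q x = u}"
      using that by auto
    moreover have "{x::'a. N q x = 0} = {0}"
      by (auto simp: N_def)
    ultimately show ?thesis
      using that card_N_fibre by auto
  qed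
  have "card ?X = (\<Sum>u\<in>?U. card {x \<in> ?X. N q x = u})"
    by (rule card_eq_sum_card_fibres) (auto simp: N_in_L)
  hence "card ?X = (\<Sum>u\<in>?U. if u = 0 then 1 else q + 1)"
    using fibre by simp
  hence "card ?X + (\<Sum>u\<in>?U. if u = 0 then q else 0) = (\<Sum>u\<in>?U. q + 1)"
    by (simp only: sum.distrib[symmetric]) (rule sum.cong, auto)
  hence "card ?X + (\<Sum>u\<in>?U. if u = 0 then q else 0) = s * (q + 1)"
    by (simp only: sum_constant card_U) simp
  moreover have "(\<Sum>u\<in>?U. if u = 0 then q else 0) = (if c = 0 then q else 0)"
    using zero_in by (subst sum.delta) (auto simp: Tr_def zero_power_sq)
  moreover have "s * (q + 1) = s ^ 3 + s"
    by (simp add: q_eq power2_eq_square power3_eq_cube algebra_simps)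
  ultimately show ?thesis
    by (simp only: q_eq[symmetric])
qed

definition Q :: "'a \<Rightarrow> 'a \<Rightarrow> 'a" where
  "Q a x = N q x - Tr q (a * x ^ s)"

lemma Q_in_L: "Q a x \<in> L"
  unfolding Q_def by (rule L_closed(4)[OF N_in_L Tr_q_in_L])

text \<open>
  Completing the square. The linear part of \<open>Tr s (l * Q a x)\<close> is a trace from \<open>F\<close> to \<open>K\<close>, and so is the
  cross term \<open>Tr s (l * Tr q (c ^ q * x))\<close> that the norm contributes when \<open>x\<close> is replaced by \<open>x + c\<close>.
  They cancel if \<open>l c^q = l^s a^(s q)\<close>, which is solved by \<open>c = l^(s - 1) a^s\<close>.
\<close>

lemma Tr_s_Q_translate:
  assumes l: "l \<in> L" "l \<noteq> 0" and e: "e \<in> L"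
  defines "t \<equiv> l ^ (s - 1)"
  shows "Tr s (l * (Q a (x + t * a ^ s) - e)) =
    Tr s (l * N q x) - Tr s (l * (t ^ 2 * N q a ^ s + e))"
proof -
  define r where "r = t ^ s"
  have "t ^ (s + 1) = 1"
    using power_s_minus_1(1)[OF l] by (simp add: t_def)
  hence rt: "r * t = 1" and "t \<noteq> 0"
    by (auto simp: r_def mult.commute)
  have ls: "l ^ s = l * t"
    using power_s_minus_1(2)[OF l] by (simp add: t_def)
  have tq: "t ^ q = t"
    using L_power[OF l(1)] by (simp add: t_def L_def)
  have rs: "r ^ s = t"
    using tq by (simp add: r_def power_q_eq)
  have ss: "(y ^ s) ^ s = y ^ q" for y :: 'a
    by (simp add: power_q_eq)
  have sq: "(y ^ s) ^ q = (y ^ q) ^ s" for y :: 'a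
    by (simp add: mult.commute flip: power_mult)
  have rq: "r ^ q = r"
    using sq[of t] tq by (simp add: r_def)
  \<comment> \<open>Since \<open>F\<close> has degree four over \<open>K\<close>, every element has four conjugates, permuted cyclically by the
    power \<open>s\<close>. In terms of the conjugates of \<open>x\<close> and \<open>a\<close>, and of \<open>t\<close> and its inverse \<open>r\<close>, the claim is a
    polynomial identity.\<close>
  define x1 x2 x3 where "x1 = x ^ s" and "x2 = x ^ q" and "x3 = (x ^ q) ^ s"
  define a1 a2 a3 where "a1 = a ^ s" and "a2 = a ^ q" and "a3 = (a ^ q) ^ s"
  have fs: "x ^ s = x1" "x1 ^ s = x2" "x2 ^ s = x3" "x3 ^ s = x"
      "a ^ s = a1" "a1 ^ s = a2" "a2 ^ s = a3" "a3 ^ s = a"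
    and fq: "x ^ q = x2" "x1 ^ q = x3" "a ^ q = a2" "a1 ^ q = a3" "a2 ^ q = a"
    by (simp_all add: x1_def x2_def x3_def a1_def a2_def a3_def ss sq power_q_power_q)
  note simps = N_def Tr_def fs fq frobenius ls tq rs rq r_def[symmetric] power_add
  have q1: "Q a (x + t * a ^ s) = (x2 + t * a3) * (x + t * a1) - a * (x1 + r * a2) - a2 * (x3 + r * a)"
    by (simp add: Q_def simps sq)
  have q2: "Q a (x + t * a ^ s) ^ s = (x3 + r * a) * (x1 + r * a2) - a1 * (x2 + t * a3) - a3 * (x + t * a1)"
    unfolding q1 by (simp add: simps)
  have lhs: "Tr s (l * (Q a (x + t * a ^ s) - e)) =
      l * ((x2 + t * a3) * (x + t * a1) - a * (x1 + r * a2) - a2 * (x3 + r * a) - e)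
      + l * t * ((x3 + r * a) * (x1 + r * a2) - a1 * (x2 + t * a3) - a3 * (x + t * a1) - e ^ s)"
    unfolding Tr_def power_mult_distrib power_s_diff q2 ls by (simp only: q1)
  have rhs: "Tr s (l * N q x) - Tr s (l * (t ^ 2 * N q a ^ s + e)) =
      l * (x2 * x) + l * t * (x3 * x1) - l * (t ^ 2 * (a3 * a1) + e) - l * t * (r ^ 2 * (a * a2) + e ^ s)"
    by (simp add: simps power2_eq_square algebra_simps)
  show ?thesis
    unfolding lhs rhs using rt by algebra
qed

text \<open>
  In the homogeneous parameters \<open>l\<close> and \<open>l^s = l t\<close> of the pencil, the discriminant is, up to a constant,
  \<open>l l^s\<close> times the homogenization of this cubic: its roots mark the degenerate quadrics.
\<close>

definition cubic :: "'a \<Rightarrow> 'a \<Rightarrow> 'a poly" where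
  "cubic a e = [:N q a, e, e ^ s, N q a ^ s:]"

text \<open>
  As \<open>l^s = l t\<close> and \<open>t^s = 1 / t\<close>, the left-hand trace becomes \<open>l / t\<close> times the value of the cubic.
\<close>

lemma Tr_s_eq_0_iff_cubic_root:
  assumes l: "l \<in> L" "l \<noteq> 0"
  defines "t \<equiv> l ^ (s - 1)"
  shows "Tr s (l * (t ^ 2 * N q a ^ s + e)) = 0 \<longleftrightarrow> poly (cubic a e) t = 0"
proof -
  have "t ^ (s + 1) = 1"
    using power_s_minus_1(1)[OF l] by (simp add: t_def)
  hence rt: "t ^ s * t = 1" "t \<noteq> 0"
    by (auto simp: mult.commute)
  have ls: "l ^ s = l * t"
    using power_s_minus_1(2)[OF l] by (simp add: t_def)
  have N: "(N q a ^ s) ^ s = N q a"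
    using N_in_L[of a] by (simp add: L_def flip: power_q_eq)
  have "Tr s (l * (t ^ 2 * N q a ^ s + e)) =
      l * (t ^ 2 * N q a ^ s + e) + l * t * ((t ^ s) ^ 2 * N q a + e ^ s)"
    by (simp add: Tr_def frobenius ls N power2_eq_square)
  also have "\<dots> * t = l * poly (cubic a e) t"
  proof -
    have "(l * (t ^ 2 * m + e) + l * t * (r ^ 2 * n + e')) * t = l * (n + t * (e + t * (e' + t * m)))"
      if "r * t = 1" for r m n e' :: 'a
      using that by algebra
    from this[OF rt(1)] show ?thesis
      by (simp add: cubic_def)
  qed
  finally show ?thesis
    using rt(2) l(2) by (metis mult_eq_0_iff)
qed

text \<open>
  The exceptional members are the cones of the pencil: after completing the square, their constant
  term vanishes.
\<close>

lemma card_pencil_member: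
  assumes l: "l \<in> L" "l \<noteq> 0" and e: "e \<in> L"
  shows "card {x. Tr s (l * (Q a x - e)) = 0}
    + (if poly (cubic a e) (l ^ (s - 1)) = 0 then s ^ 2 else 0) = s ^ 3 + s"
proof -
  define t where "t = l ^ (s - 1)"
  define k where "k = Tr s (l * (t ^ 2 * N q a ^ s + e))"
  have "k \<in> K"
    unfolding k_def t_def
    using Tr_s_in_K[OF L_closed(1)[OF l(1) L_closed(3)[OF L_closed(1)[OF L_power[OF L_power[OF l(1)]] L_power[OF N_in_L]] e]]] .
  have "Tr s (l * (Q a (x + t * a ^ s) - e)) = 0 \<longleftrightarrow> Tr s (l * N q x) = k" for x
    using Tr_s_Q_translate[OF l e, of a x] by (simp add: t_def k_def)
  hence "card {x. Tr s (l * (Q a x - e)) = 0} = card {x. Tr s (l * N q x) = k}"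
    using card_Collect_translate[of "\<lambda>x. Tr s (l * (Q a x - e)) = 0" "t * a ^ s"] by simp
  thus ?thesis
    using card_Tr_s_norm_fibre[OF l \<open>k \<in> K\<close>] Tr_s_eq_0_iff_cubic_root[OF l, of a e]
    by (simp add: k_def t_def)
qed

text \<open>
  Count the pairs \<open>(l, x)\<close> with \<open>x\<close> on the member \<open>l\<close>. A common point \<open>x\<close> of the pencil lies on
  all \<open>q - 1\<close> members. For any other \<open>x\<close> the nonzero \<open>l\<close> in the kernel of a nonzero
  \<open>K\<close>-linear form on \<open>L\<close> qualify; there are \<open>s - 1\<close> of them.
\<close>

lemma card_Q_fibre:
  assumes "a \<noteq> 0" and e: "e \<in> L"
  shows "\<exists>z\<le>3. card {x. Q a x = e} + z * s = q + s + 1"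
proof -
  let ?P = "\<lambda>l x. Tr s (l * (Q a x - e)) = 0"
  let ?L = "L - {0}"
  let ?n = "card {x. Q a x = e}"
  define Z where "Z = {t. t ^ (s + 1) = 1 \<and> poly (cubic a e) t = 0}"
  define R where "R = {l \<in> ?L. poly (cubic a e) (l ^ (s - 1)) = 0}"
  have "cubic a e \<noteq> 0" "degree (cubic a e) \<le> 3"
    using \<open>a \<noteq> 0\<close> by (auto simp: cubic_def N_def)
  hence "card {t. poly (cubic a e) t = 0} \<le> 3"
    using card_poly_roots_bound le_trans by blast
  moreover have "card Z \<le> card {t. poly (cubic a e) t = 0}"
    by (rule card_mono) (auto simp: Z_def)
  ultimately have "card Z \<le> 3" by simp
  \<comment> \<open>Each root \<open>t\<close> accounts for the \<open>s - 1\<close> scalars \<open>l\<close> with \<open>l^(s - 1) = t\<close>.\<close>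
  have "card R = (\<Sum>t\<in>Z. card {l \<in> R. l ^ (s - 1) = t})"
    by (rule card_eq_sum_card_fibres) (use power_s_minus_1(1) in \<open>auto simp: R_def Z_def\<close>)
  also have "\<dots> = (\<Sum>t\<in>Z. s - 1)"
  proof (rule sum.cong)
    fix t assume "t \<in> Z"
    moreover from this have "{l \<in> R. l ^ (s - 1) = t} = {l \<in> ?L. l ^ (s - 1) = t}"
      by (auto simp: R_def Z_def)
    ultimately show "card {l \<in> R. l ^ (s - 1) = t} = s - 1"
      using card_power_s_minus_1_fibre by (simp add: Z_def)
  qed simp
  finally have card_R: "card R = card Z * (s - 1)" by simp
  have by_x: "card {l \<in> ?L. ?P l x} = (if Q a x = e then q - s else 0) + (s - 1)" for x
  proof (cases "Q a x = e")
    case True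
    hence "{l \<in> ?L. ?P l x} = ?L"
      by (auto simp: Tr_def zero_power_sq)
    thus ?thesis
      using True card_L_nonzero two_s_le_q s_ge_2 by simp
  next
    case False
    have "card {l \<in> L. Tr s ((Q a x - e) * l) = 0} = s"
      by (rule card_Tr_s_mult_fibre) (use False L_closed(4)[OF Q_in_L e] zero_in in auto)
    moreover have "{l \<in> ?L. ?P l x} = {l \<in> L. Tr s ((Q a x - e) * l) = 0} - {0}"
      by (auto simp: mult.commute)
    moreover have "0 \<in> {l \<in> L. Tr s ((Q a x - e) * l) = 0}"
      by (auto simp: Tr_def zero_power_sq zero_in)
    ultimately show ?thesis
      using False by (simp only: card_Diff_singleton) simp
  qed
  have "(\<Sum>l\<in>?L. card {x \<in> UNIV. ?P l x})
      = (\<Sum>x\<in>UNIV. (if Q a x = e then q - s else 0) + (s - 1))"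
    by (rule sum_multicount_gen) (use by_x in auto)
  also have "\<dots> = ?n * (q - s) + q ^ 2 * (s - 1)"
    by (simp add: sum.distrib sum.If_cases card_F)
  finally have double: "(\<Sum>l\<in>?L. card {x. ?P l x}) = ?n * (q - s) + q ^ 2 * (s - 1)"
    by simp
  have "(\<Sum>l\<in>?L. card {x. ?P l x} + (if poly (cubic a e) (l ^ (s - 1)) = 0 then s ^ 2 else 0))
      = (\<Sum>l\<in>?L. s ^ 3 + s)"
    by (rule sum.cong) (use card_pencil_member e in auto)
  moreover have "(\<Sum>l\<in>?L. if poly (cubic a e) (l ^ (s - 1)) = 0 then s ^ 2 else 0) = card R * s ^ 2"
    by (simp add: sum.If_cases R_def Int_def)
  ultimately have "?n * (q - s) + q ^ 2 * (s - 1) + card Z * (s - 1) * s ^ 2 = (q - 1) * (s ^ 3 + s)"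
    using double card_R card_L_nonzero by (simp add: sum.distrib)
  moreover obtain r where r: "s = Suc r" "r > 0"
    using s_ge_2 by (metis Suc_le_D Suc_le_lessD numeral_2_eq_2 Suc_less_eq)
  moreover have "q - s = s * r" "q - 1 = r * (s + 1)"
    by (simp_all add: q_eq r power2_eq_square algebra_simps)
  ultimately have "?n * (s * r) + q ^ 2 * r + card Z * r * s ^ 2 = r * (s + 1) * (s ^ 3 + s)"
    by simp
  \<comment> \<open>With \<open>q = s^2\<close> every term is divisible by \<open>s r\<close>.\<close>
  hence "(s * r) * (?n + card Z * s) = (s * r) * (q + s + 1)"
    unfolding q_eq by (simp add: eval_nat_numeral algebra_simps)
  moreover have "s * r \<noteq> 0"
    using r by simp
  ultimately have "?n + card Z * s = q + s + 1"
    by (simp only: mult_cancel1) simp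
  thus ?thesis
    using \<open>card Z \<le> 3\<close> by blast
qed


section \<open>Intersections with the lines off the distinguished point\<close>

definition line_count :: "'a \<Rightarrow> 'a \<Rightarrow> 'a \<Rightarrow> nat" where
  "line_count a m b = card {x. Tr q (m * x + b + a * x ^ s) = N q x}"

text \<open>
  Translating \<open>x\<close> by \<open>m^q\<close> produces the cross term \<open>Tr q (m * x)\<close> in the norm, which cancels the slope.
  The new constants combine to \<open>N q m\<close> because \<open>Tr q (m * m ^ q) = 2 N q m\<close>, one copy of which is
  absorbed by the norm of \<open>m^q\<close>.
\<close>

lemma line_count_eq_card_Q_fibre:
  "line_count a m b = card {x. Q a x = Tr q (b + a * (m ^ q) ^ s) + N q m}"
proof -
  have "Tr q (m * (x + m ^ q) + b + a * (x + m ^ q) ^ s) = N q (x + m ^ q) \<longleftrightarrow>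
      Q a x = Tr q (b + a * (m ^ q) ^ s) + N q m" for x
    by (auto simp: Q_def Tr_def N_def frobenius power_add algebra_simps)
  thus ?thesis
    unfolding line_count_def
    using card_Collect_translate[of "\<lambda>x. Tr q (m * x + b + a * x ^ s) = N q x" "m ^ q"] by simp
qed

lemma line_count_cases:
  assumes "a \<noteq> 0"
  shows "line_count a m b \<in> {q + 1 - 2 * s, q + 1 - s, q + 1, q + s + 1}"
proof -
  obtain z where z: "z \<le> 3" "line_count a m b + z * s = q + s + 1"
    using card_Q_fibre[OF assms L_closed(3)[OF Tr_q_in_L N_in_L]]
    unfolding line_count_eq_card_Q_fibre by blast
  have "z = 0 \<or> z = 1 \<or> z = 2 \<or> z = 3"
    using z(1) by auto
  thus ?thesis
    using z(2) two_s_le_q by auto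
qed

text \<open>
  The trace is onto \<open>L\<close>, so the constant \<open>N q m\<close> is a trace as well and the dependence on \<open>m\<close> is a mere
  translation of \<open>b\<close>.
\<close>

lemma card_line_count_slope_invariant:
  "card {b. line_count a m b = k} = card {b. card {x. Q a x = Tr q b} = k}"
proof -
  have "card {x. Tr q x = N q m} > 0"
    using card_Tr_q_fibre[OF N_in_L, of m] two_s_le_q s_ge_2 by simp
  then obtain d where d: "Tr q d = N q m"
    by (metis (mono_tags, lifting) card.empty empty_Collect_eq less_irrefl)
  have *: "line_count a m b = card {x. Q a x = Tr q (b + (a * (m ^ q) ^ s + d))}" for b
    unfolding line_count_eq_card_Q_fibre d[symmetric] by (simp add: Tr_def frobenius algebra_simps)
  show ?thesis
    unfolding *
    by (rule card_Collect_translate[of "\<lambda>b. card {x. Q a x = Tr q b} = k"])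
qed

end


section \<open>Points and lines of the projective plane in coordinates\<close>

lemma vec3_eq_iff: "(v :: 'a ^ 3) = w \<longleftrightarrow> v $ 1 = w $ 1 \<and> v $ 2 = w $ 2 \<and> v $ 3 = w $ 3"
  by (simp add: vec_eq_iff forall_3)

lemma span_singleton_subset_iff:
  "vec.subspace l \<Longrightarrow> vec.span {v} \<subseteq> l \<longleftrightarrow> v \<in> l"
  by (meson empty_subsetI insert_subset subset_trans vec.span_minimal vec.span_superset)

lemma mem_span_singleton_iff: "w \<in> vec.span {v} \<longleftrightarrow> (\<exists>k. w = k *s v)"
  by (auto simp: vec.span_singleton)

lemma span_scale: "k \<noteq> 0 \<Longrightarrow> vec.span {k *s v} = vec.span {v}"
proof (intro subset_antisym subsetI)
  fix w assume "k \<noteq> 0" "w \<in> vec.span {v}"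
  then obtain c where "w = (c / k) *s (k *s v)"
    by (auto simp: mem_span_singleton_iff)
  thus "w \<in> vec.span {k *s v}"
    unfolding mem_span_singleton_iff by blast
qed (auto simp: mem_span_singleton_iff)

lemma span_singleton_in_pg_points: "v \<noteq> 0 \<Longrightarrow> vec.span {v} \<in> pg_points"
  by (simp add: pg_points_def vec.dim_span_eq_card_independent)

lemma pg_pointsE:
  assumes "P \<in> pg_points"
  obtains v where "v \<noteq> 0" "P = vec.span {v}"
proof -
  obtain B where B: "B \<subseteq> P" "vec.independent B" "P \<subseteq> vec.span B" "card B = vec.dim P"
    using vec.basis_exists by blast
  then obtain v where "B = {v}"
    using assms by (auto simp: pg_points_def card_1_singleton_iff)
  with B that[of v] assms show ?thesis
    by (auto simp: pg_points_def vec.span_minimal subset_antisym)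
qed

text \<open>
  Every point is of one of three shapes, according to its first nonzero coordinate in the order
  third, first, second. A \<open>slope_point\<close> is the direction of the affine lines of the given slope,
  and \<open>vertical_point\<close> is the direction of the vertical ones.
\<close>

definition affine_point :: "'a::field \<Rightarrow> 'a \<Rightarrow> ('a ^ 3) set" where
  "affine_point x y = vec.span {vector [x, y, 1]}"

definition slope_point :: "'a::field \<Rightarrow> ('a ^ 3) set" where
  "slope_point m = vec.span {vector [1, m, 0]}"

definition vertical_point :: "('a::field ^ 3) set" where
  "vertical_point = vec.span {vector [0, 1, 0]}"

lemmas point_defs = affine_point_def slope_point_def vertical_point_def

lemma pg_points_cases:
  assumes "P \<in> pg_points"
  obtains (affine) x y where "P = affine_point x y"
  | (slope) m where "P = slope_point m"
  | (vertical) "P = vertical_point"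
proof -
  obtain v where v: "v \<noteq> 0" "P = vec.span {v}"
    using assms by (rule pg_pointsE)
  consider "v $ 3 \<noteq> 0" | "v $ 3 = 0" "v $ 1 \<noteq> 0" | "v $ 3 = 0" "v $ 1 = 0" "v $ 2 \<noteq> 0"
    using v(1) by (auto simp: vec3_eq_iff)
  thus ?thesis
  proof cases
    case 1
    have "v = v $ 3 *s vector [v $ 1 / v $ 3, v $ 2 / v $ 3, 1]"
      using 1 by (simp add: vec3_eq_iff)
    thus ?thesis
      using affine v(2) 1 span_scale unfolding affine_point_def by metis
  next
    case 2
    have "v = v $ 1 *s vector [1, v $ 2 / v $ 1, 0]"
      using 2 by (simp add: vec3_eq_iff)
    thus ?thesis
      using slope v(2) 2 span_scale unfolding slope_point_def by metis
  next
    case 3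
    have "v = v $ 2 *s vector [0, 1, 0]"
      using 3 by (simp add: vec3_eq_iff)
    thus ?thesis
      using vertical v(2) 3 span_scale unfolding vertical_point_def by metis
  qed
qed

lemma span_singleton_eqD: "vec.span {v} = vec.span {w} \<Longrightarrow> \<exists>k. v = k *s w"
  by (metis mem_span_singleton_iff singletonI vec.span_base)

lemma affine_point_eq_iff [simp]: "affine_point x y = affine_point x' y' \<longleftrightarrow> x = x' \<and> y = y'"
  unfolding affine_point_def by (auto dest!: span_singleton_eqD simp: vec3_eq_iff)

lemma affine_point_neq_vertical_point [simp]:
  "affine_point x y \<noteq> vertical_point" "vertical_point \<noteq> affine_point x y"
  unfolding point_defs by (auto dest!: span_singleton_eqD simp: vec3_eq_iff)

definition graph_line :: "'a::field \<Rightarrow> 'a \<Rightarrow> ('a ^ 3) set" where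
  "graph_line m b = {v. v $ 2 = m * v $ 1 + b * v $ 3}"

definition vertical_line :: "'a::field \<Rightarrow> ('a ^ 3) set" where
  "vertical_line c = {v. v $ 1 = c * v $ 3}"

definition line_at_infinity :: "('a::field ^ 3) set" where
  "line_at_infinity = {v. v $ 3 = 0}"

lemmas line_defs = graph_line_def vertical_line_def line_at_infinity_def

lemma subspace_lines:
  "vec.subspace (graph_line m b)" "vec.subspace (vertical_line c)" "vec.subspace line_at_infinity"
  by (auto simp: line_defs vec.subspace_def algebra_simps)

lemma pg_linesI:
  assumes "vec.subspace l" "u \<in> l" "w \<in> l"
    and indep: "\<And>k. w \<noteq> k *s u" "u \<noteq> 0"
    and spans: "\<And>v. v \<in> l \<Longrightarrow> \<exists>j k. v = j *s u + k *s w"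
  shows "l \<in> pg_lines"
proof -
  have "w \<notin> vec.span {u}"
    using indep by (auto simp: mem_span_singleton_iff)
  moreover from this have "w \<noteq> u"
    using vec.span_base by blast
  ultimately have "vec.independent {w, u}" "card {w, u} = 2"
    using indep(2) by (auto simp: vec.independent_insert)
  moreover have "l \<subseteq> vec.span {w, u}"
  proof
    fix v assume "v \<in> l"
    then obtain j k where "v = j *s u + k *s w"
      using spans by blast
    thus "v \<in> vec.span {w, u}"
      by (auto intro!: vec.span_add vec.span_scale intro: vec.span_base)
  qed
  ultimately have "vec.dim l = 2"
    using assms(2,3) by (intro vec.dim_unique[of "{w, u}"]) auto
  thus ?thesis
    using assms(1) by (simp add: pg_lines_def)
qed

lemma lines_in_pg_lines:
  "graph_line m b \<in> pg_lines" "vertical_line c \<in> pg_lines" "line_at_infinity \<in> pg_lines"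
proof -
  show "graph_line m b \<in> pg_lines"
    by (rule pg_linesI[OF subspace_lines(1), of "vector [1, m, 0]" _ _ "vector [0, b, 1]"])
      (auto simp: graph_line_def vec3_eq_iff algebra_simps)
  show "vertical_line c \<in> pg_lines"
    by (rule pg_linesI[OF subspace_lines(2), of "vector [0, 1, 0]" _ "vector [c, 0, 1]"])
      (auto simp: vertical_line_def vec3_eq_iff algebra_simps)
  show "line_at_infinity \<in> pg_lines"
    by (rule pg_linesI[OF subspace_lines(3), of "vector [1, 0, 0]" "vector [0, 1, 0]"])
      (auto simp: line_at_infinity_def vec3_eq_iff algebra_simps)
qed

text \<open>
  Both subspaces have dimension two.
\<close>

lemma pg_lines_subset_imp_eq:
  "\<lbrakk>l \<in> pg_lines; l' \<in> pg_lines; l \<subseteq> l'\<rbrakk> \<Longrightarrow> l = l'"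
  by (rule vec.subspace_dim_equal) (simp_all add: pg_lines_def)

lemma pg_linesE:
  assumes "l \<in> pg_lines"
  obtains u w where "l = vec.span {u, w}" "\<forall>j k. j *s u + k *s w = 0 \<longrightarrow> j = 0 \<and> k = 0"
proof -
  obtain B where B: "B \<subseteq> l" "vec.independent B" "l \<subseteq> vec.span B" "card B = vec.dim l"
    using vec.basis_exists by blast
  then obtain u w where uw: "B = {u, w}" "u \<noteq> w"
    using assms by (auto simp: pg_lines_def card_2_iff)
  have "l = vec.span {u, w}"
    using B uw assms by (auto simp: pg_lines_def vec.span_minimal subset_antisym)
  moreover have "j = 0 \<and> k = 0" if "j *s u + k *s w = 0" for j k
  proof -
    have "(\<Sum>v\<in>{u, w}. (if v = u then j else k) *s v) = 0"
      using that uw(2) by simp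
    hence "\<forall>v\<in>{u, w}. (if v = u then j else k) = 0"
      using B(2) uw(1) vec.independentD[of B B "\<lambda>v. if v = u then j else k"] by blast
    thus ?thesis
      using uw(2) by auto
  qed
  ultimately show ?thesis
    using that by blast
qed

lemma pg_lines_cases:
  fixes l :: "('a::field ^ 3) set"
  assumes l: "l \<in> pg_lines"
  obtains (graph) m b where "l = graph_line m b"
  | (vertical) c where "l = vertical_line c"
  | (infinity) "l = line_at_infinity"
proof -
  obtain u w where uw: "l = vec.span {u, w}"
    and indep: "\<forall>j k. j *s u + k *s w = 0 \<longrightarrow> j = 0 \<and> k = 0"
    using l by (rule pg_linesE)
  \<comment> \<open>The vector product of \<open>u\<close> and \<open>w\<close> is the coefficient vector of an equation for \<open>l\<close>.\<close>
  define n1 n2 n3 where "n1 = u $ 2 * w $ 3 - u $ 3 * w $ 2"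
    and "n2 = u $ 3 * w $ 1 - u $ 1 * w $ 3" and "n3 = u $ 1 * w $ 2 - u $ 2 * w $ 1"
  note n_defs = n1_def n2_def n3_def
  have nonzero: "n1 \<noteq> 0 \<or> n2 \<noteq> 0 \<or> n3 \<noteq> 0"
  proof (rule ccontr)
    assume "\<not> ?thesis"
    hence "w $ i *s u + (- (u $ i)) *s w = 0" for i
      using exhaust_3[of i] by (auto simp: n_defs vec3_eq_iff algebra_simps)
    hence "w $ i = 0" for i
      using indep by blast
    hence "w = 0"
      by (simp add: vec_eq_iff)
    thus False
      using indep by (metis add.left_neutral vector_smult_lid vector_smult_lzero zero_neq_one)
  qed
  have orth: "n1 * u $ 1 + n2 * u $ 2 + n3 * u $ 3 = 0" "n1 * w $ 1 + n2 * w $ 2 + n3 * w $ 3 = 0"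
    by (simp_all add: n_defs algebra_simps)
  have eqI: "l = l'" if "l' \<in> pg_lines" "vec.subspace l'"
      "\<And>v. n1 * v $ 1 + n2 * v $ 2 + n3 * v $ 3 = 0 \<Longrightarrow> v \<in> l'" for l'
    using that orth by (intro pg_lines_subset_imp_eq l) (simp_all add: uw vec.span_minimal)
  consider "n2 \<noteq> 0" | "n2 = 0" "n1 \<noteq> 0" | "n2 = 0" "n1 = 0" "n3 \<noteq> 0"
    using nonzero by blast
  thus ?thesis
  proof cases
    case 1
    have "l = graph_line (- n1 / n2) (- n3 / n2)"
    proof (rule eqI)
      fix v :: "'a ^ 3"
      assume "n1 * v $ 1 + n2 * v $ 2 + n3 * v $ 3 = 0"
      hence "n2 * v $ 2 = - n1 * v $ 1 - n3 * v $ 3"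
        by algebra
      thus "v \<in> graph_line (- n1 / n2) (- n3 / n2)"
        using 1 by (simp add: graph_line_def field_simps)
    qed (fact lines_in_pg_lines subspace_lines)+
    thus ?thesis by (rule graph)
  next
    case 2
    have "l = vertical_line (- n3 / n1)"
    proof (rule eqI)
      fix v :: "'a ^ 3"
      assume "n1 * v $ 1 + n2 * v $ 2 + n3 * v $ 3 = 0"
      hence "n1 * v $ 1 = - n3 * v $ 3"
        using 2(1) by algebra
      thus "v \<in> vertical_line (- n3 / n1)"
        using 2(2) by (simp add: vertical_line_def field_simps)
    qed (fact lines_in_pg_lines subspace_lines)+
    thus ?thesis by (rule vertical)
  next
    case 3
    have "l = line_at_infinity"
      by (rule eqI[OF lines_in_pg_lines(3) subspace_lines(3)])
        (use 3 in \<open>simp add: line_at_infinity_def\<close>)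
    thus ?thesis by (rule infinity)
  qed
qed

lemma incidence [simp]:
  "affine_point x y \<subseteq> graph_line m b \<longleftrightarrow> y = m * x + b"
  "affine_point x y \<subseteq> vertical_line c \<longleftrightarrow> x = c"
  "\<not> affine_point x y \<subseteq> line_at_infinity"
  "slope_point m \<subseteq> graph_line m' b \<longleftrightarrow> m = m'"
  "\<not> slope_point m \<subseteq> vertical_line c"
  "slope_point m \<subseteq> line_at_infinity"
  "\<not> vertical_point \<subseteq> graph_line m b"
  "vertical_point \<subseteq> vertical_line c"
  "vertical_point \<subseteq> line_at_infinity"
  unfolding point_defs by (simp_all add: span_singleton_subset_iff subspace_lines)
    (simp_all add: line_defs)

lemma line_at_infinity_neq_graph_line [simp]: "line_at_infinity \<noteq> graph_line m b"
  by (metis incidence(7,9))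

lemma inj_graph_line: "inj (graph_line m)"
  by (rule injI) (metis incidence(1) add_left_cancel)


section \<open>The homogeneous equation of the curve\<close>

context gf_biquadratic
begin

lemma degree_bounds: "4 \<le> q" "s \<le> s * q" "q + 1 < s * q" "s < q"
proof -
  have "2 * 2 \<le> s * s"
    using s_ge_2 by (intro mult_mono) auto
  thus "4 \<le> q"
    by (simp add: q_eq power2_eq_square)
  moreover have "2 * q \<le> s * q"
    using s_ge_2 by simp
  ultimately show "s \<le> s * q" "q + 1 < s * q" "s < q"
    using two_s_le_q s_ge_2 by linarith+
qed

lemma Gamma_poly_eq:
  "Gamma_poly q s a =
    pCons (monom a s + monom (a ^ q) (s * q) - monom 1 (q + 1)) [:1:] + monom 1 q"
  for a :: 'a
proof -
  have x: "(poly_x :: 'a poly poly) = [:monom 1 1:]" and y: "(poly_y :: 'a poly poly) = monom 1 1"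
    by (simp_all add: poly_x_def poly_y_def monom_altdef)
  have "Gamma_poly q s a = [:0, 1:] + [:monom a s:] + (monom 1 q + [:monom a s ^ q:]) - [:monom 1 1 ^ (q + 1):]"
    unfolding Gamma_poly_def Tr_def N_def x y
    by (simp add: power_q_add monom_power poly_const_pow smult_monom) (simp add: monom_altdef)
  thus ?thesis
    by (simp only: monom_power) (simp add: monom_power)
qed

text \<open>
  The inequalities in \<open>degree_bounds\<close> keep the five monomials apart.
\<close>

lemma coeff_Gamma_poly:
  fixes a :: 'a
  shows "coeff (coeff (Gamma_poly q s a) j) i =
    (if (i, j) = (0, 1) then 1 else if (i, j) = (s, 0) then a else if (i, j) = (0, q) then 1
     else if (i, j) = (s * q, 0) then a ^ q else if (i, j) = (q + 1, 0) then -1 else 0)"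
  using degree_bounds by (cases j) (auto simp: Gamma_poly_eq coeff_pCons split: nat.splits)

lemma monomials2_Gamma_poly:
  assumes "a \<noteq> (0 :: 'a)"
  shows "monomials2 (Gamma_poly q s a) = {(0, 1), (s, 0), (0, q), (s * q, 0), (q + 1, 0)}"
  using assms unfolding monomials2_def coeff_Gamma_poly by auto

lemma total_degree2_Gamma_poly:
  assumes "a \<noteq> (0 :: 'a)"
  shows "total_degree2 (Gamma_poly q s a) = s * q"
  unfolding total_degree2_def monomials2_Gamma_poly[OF assms]
  by (rule Max_eqI) (use degree_bounds s_ge_2 in auto)

lemma homogenization2_Gamma_poly:
  assumes "a \<noteq> (0 :: 'a)"
  shows "homogenization2 (Gamma_poly q s a) v =
    v $ 2 * v $ 3 ^ (s * q - 1) + a * v $ 1 ^ s * v $ 3 ^ (s * q - s)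
    + v $ 2 ^ q * v $ 3 ^ (s * q - q) + a ^ q * v $ 1 ^ (s * q)
    - v $ 1 ^ (q + 1) * v $ 3 ^ (s * q - (q + 1))"
proof -
  have "s \<noteq> s * q" "q + 1 \<noteq> s * q" "s \<noteq> q + 1" "s \<noteq> 0" "q \<noteq> 1" "q \<noteq> 0"
    using degree_bounds s_ge_2 by linarith+
  thus ?thesis
    unfolding homogenization2_def monomials2_Gamma_poly[OF assms]
      total_degree2_Gamma_poly[OF assms]
    by (simp add: coeff_Gamma_poly)
qed

lemma homogenization2_scale:
  assumes "a \<noteq> (0 :: 'a)"
  shows "homogenization2 (Gamma_poly q s a) (k *s v) =
    k ^ (s * q) * homogenization2 (Gamma_poly q s a) v"
proof -
  have *: "(k * x) ^ i * (k * z) ^ (s * q - i) = k ^ (s * q) * (x ^ i * z ^ (s * q - i))"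
    if "i \<le> s * q" for x z i
    using that by (simp add: power_mult_distrib power_add[symmetric] mult_ac)
  have 1: "1 \<le> s * q" "q + 1 \<le> s * q" "q \<le> s * q"
    using degree_bounds by linarith+
  show ?thesis
    unfolding homogenization2_Gamma_poly[OF assms]
    using *[OF 1(1), of "v $ 2" "v $ 3"] *[OF degree_bounds(2), of "v $ 1" "v $ 3"]
      *[OF 1(3), of "v $ 2" "v $ 3"] *[OF 1(2), of "v $ 1" "v $ 3"]
    by (simp add: power_mult_distrib[of k "v $ 1" "s * q"] distrib_left right_diff_distrib mult.assoc mult.left_commute[of a] mult.left_commute[of "a ^ q"] del: power_Suc)
qed

text \<open>
  Homogeneity makes the choice of the representative \<open>v\<close> irrelevant.
\<close>

lemma span_in_curve_iff:
  assumes "a \<noteq> (0 :: 'a)" "v \<noteq> 0"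
  shows "vec.span {v} \<in> projective_curve_points (Gamma_poly q s a) \<longleftrightarrow>
    homogenization2 (Gamma_poly q s a) v = 0"
proof
  assume "homogenization2 (Gamma_poly q s a) v = 0"
  thus "vec.span {v} \<in> projective_curve_points (Gamma_poly q s a)"
    by (auto simp: projective_curve_points_def span_singleton_in_pg_points assms(2)
        mem_span_singleton_iff homogenization2_scale[OF assms(1)])
qed (use assms(2) vec.span_base[of v "{v}"] in \<open>auto simp: projective_curve_points_def\<close>)

lemma curve_points [simp]:
  fixes a :: 'a
  assumes "a \<noteq> 0"
  defines "X \<equiv> projective_curve_points (Gamma_poly q s a)"
  shows "affine_point x y \<in> X \<longleftrightarrow> Tr q (y + a * x ^ s) = N q x"
    and "vertical_point \<in> X"
    and "slope_point m \<notin> X"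
proof -
  have nz: "vector [x, y, 1] \<noteq> (0 :: 'a ^ 3)" "vector [0, 1, 0] \<noteq> (0 :: 'a ^ 3)"
      "vector [1, m, 0] \<noteq> (0 :: 'a ^ 3)"
    by (simp_all add: vec3_eq_iff)
  \<comment> \<open>At infinity only the monomial of top degree \<open>s q\<close> survives, so the first coordinate must vanish.\<close>
  have "s * q - 1 \<noteq> 0" "s * q - s \<noteq> 0" "s * q - q \<noteq> 0" "s * q - (q + 1) \<noteq> 0" "s * q \<noteq> 0"
    using degree_bounds two_s_le_q s_ge_2 by linarith+
  thus "vertical_point \<in> X" "slope_point m \<notin> X"
    unfolding X_def point_defs nz[THEN span_in_curve_iff[OF assms(1)]]
    using \<open>a \<noteq> 0\<close> by (simp_all add: homogenization2_Gamma_poly power_0_left)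
  have "(x ^ s) ^ q = x ^ (s * q)"
    by (simp add: power_mult)
  hence "homogenization2 (Gamma_poly q s a) (vector [x, y, 1]) = Tr q (y + a * x ^ s) - N q x"
    by (simp add: homogenization2_Gamma_poly[OF \<open>a \<noteq> 0\<close>] Tr_def N_def frobenius algebra_simps)
  thus "affine_point x y \<in> X \<longleftrightarrow> Tr q (y + a * x ^ s) = N q x"
    unfolding X_def point_defs nz(1)[THEN span_in_curve_iff[OF assms(1)]] by simp
qed

lemma curve_eq:
  fixes a :: 'a
  assumes "a \<noteq> 0"
  shows "projective_curve_points (Gamma_poly q s a) = insert vertical_point
    ((\<lambda>(x, y). affine_point x y) ` (SIGMA x:UNIV. {y. Tr q (y + a * x ^ s) = N q x}))"
proof -
  have "P \<in> projective_curve_points (Gamma_poly q s a) \<Longrightarrow> P \<in> pg_points" for P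
    by (simp add: projective_curve_points_def)
  hence "P \<in> projective_curve_points (Gamma_poly q s a) \<longleftrightarrow> P = vertical_point \<or>
      (\<exists>x y. P = affine_point x y \<and> Tr q (y + a * x ^ s) = N q x)" for P
    using assms by (metis curve_points pg_points_cases)
  thus ?thesis
    by auto
qed

lemma card_vertical_fibre: "card {y. Tr q (y + a * x ^ s) = N q (x :: 'a)} = q"
proof -
  have "Tr q (y + a * x ^ s) = N q x \<longleftrightarrow> Tr q y = Q a x" for y
    by (auto simp: Q_def Tr_def frobenius algebra_simps)
  thus ?thesis
    using card_Tr_q_fibre[OF Q_in_L] by simp
qed

lemma card_curve:
  assumes "a \<noteq> (0 :: 'a)"
  shows "card (projective_curve_points (Gamma_poly q s a)) = q ^ 3 + 1"
proof -
  have "card ((\<lambda>(x, y). affine_point x y) ` (SIGMA x:UNIV. {y. Tr q (y + a * x ^ s) = N q x}))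
      = q ^ 3"
    by (subst card_image)
      (auto simp: inj_on_def card_vertical_fibre card_F power2_eq_square power3_eq_cube)
  thus ?thesis
    unfolding curve_eq[OF assms] by (subst card_insert_disjoint) auto
qed


section \<open>Secants of the curve\<close>

lemma card_points_on_graph_line:
  fixes a :: 'a
  assumes "a \<noteq> 0"
  defines "X \<equiv> projective_curve_points (Gamma_poly q s a)"
  shows "card (points_on X (graph_line m b)) = line_count a m b"
proof -
  have "points_on X (graph_line m b) = (\<lambda>x. affine_point x (m * x + b)) `
      {x. Tr q (m * x + b + a * x ^ s) = N q x}"
    unfolding X_def curve_eq[OF assms(1)] points_on_def
    by (rule set_eqI) (auto del: subsetI)
  moreover have "inj (\<lambda>x. affine_point x (m * x + b))"
    by (rule injI) simp
  ultimately show ?thesis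
    by (simp add: line_count_def card_image inj_on_subset)
qed

lemma card_points_on_vertical_line:
  fixes a :: 'a
  assumes "a \<noteq> 0"
  defines "X \<equiv> projective_curve_points (Gamma_poly q s a)"
  shows "card (points_on X (vertical_line c)) = q + 1"
proof -
  have "points_on X (vertical_line c) =
      insert vertical_point (affine_point c ` {y. Tr q (y + a * c ^ s) = N q c})"
    unfolding X_def curve_eq[OF assms(1)] points_on_def
    by (rule set_eqI) (auto del: subsetI)
  moreover have "inj (affine_point c)"
    by (rule injI) simp
  ultimately show ?thesis
    by (auto simp: card_insert_if card_image inj_on_subset card_vertical_fibre)
qed

lemma points_on_line_at_infinity:
  fixes a :: 'a
  assumes "a \<noteq> 0"
  defines "X \<equiv> projective_curve_points (Gamma_poly q s a)"
  shows "points_on X line_at_infinity = {vertical_point}"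
  unfolding X_def curve_eq[OF assms(1)] points_on_def
  by (rule set_eqI) (auto del: subsetI)

text \<open>
  The lines through a point at infinity other than the distinguished one are the affine lines of one
  slope and the line at infinity. The latter is a 1-secant, which matters since 1 may be one of the
  intersection numbers: \<open>q + 1 - 2 * s = 1\<close> for \<open>s = 2\<close>.
\<close>

lemma card_secants_through_slope_point:
  fixes a :: 'a
  assumes "a \<noteq> 0"
  defines "X \<equiv> projective_curve_points (Gamma_poly q s a)"
  shows "card {l. secant X k l \<and> slope_point m \<subseteq> l} =
    card {b. card {x. Q a x = Tr q b} = k} + (if k = 1 then 1 else 0)"
proof -
  have "{l. secant X k l \<and> slope_point m \<subseteq> l} =
      graph_line m ` {b. line_count a m b = k} \<union> (if k = 1 then {line_at_infinity} else {})"
    (is "?S = ?G \<union> ?I")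
  proof (intro subset_antisym subsetI)
    fix l assume "l \<in> ?S"
    thus "l \<in> ?G \<union> ?I"
      by (auto simp: secant_def X_def card_points_on_graph_line[OF assms(1)]
          points_on_line_at_infinity[OF assms(1)] elim!: pg_lines_cases)
  qed (auto simp: secant_def X_def card_points_on_graph_line[OF assms(1)] lines_in_pg_lines
      points_on_line_at_infinity[OF assms(1)] split: if_splits simp del: One_nat_def del: subsetI)
  moreover have "?G \<inter> ?I = {}"
    by (auto split: if_splits)
  moreover have "card ?G = card {b. card {x. Q a x = Tr q b} = k}"
    using card_line_count_slope_invariant inj_graph_line by (metis card_image inj_on_subset subset_UNIV)
  ultimately show ?thesis
    by (simp add: card_Un_disjoint)
qed

lemma regular_pointed_type_curve:
  fixes a :: 'a
  assumes "a \<noteq> 0"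
  shows "regular_pointed_type q [q + 1 - 2 * s, q + 1 - s, q + 1, q + s + 1]
    (projective_curve_points (Gamma_poly q s a))" (is "regular_pointed_type q ?ms ?X")
  unfolding regular_pointed_type_def
proof (intro conjI; (rule bexI[of _ vertical_point], rule bexI[of _ line_at_infinity],
      intro conjI ballI impI)?)
  show "?X \<subseteq> pg_points"
    by (auto simp: projective_curve_points_def)
  show "0 < q"
    using degree_bounds by simp
  show "points_on ?X line_at_infinity = {vertical_point}"
    using points_on_line_at_infinity[OF assms] .
  show "\<exists>m\<in>set ?ms. secant ?X m l" if "l \<in> pg_lines" "\<not> vertical_point \<subseteq> l" for l
    using that(1)
  proof (cases rule: pg_lines_cases)
    case (graph m b)
    thus ?thesis
      using line_count_cases[OF assms, of m b] that(1)
      by (auto simp: secant_def card_points_on_graph_line[OF assms])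
  qed (use that(2) in auto)
  show "secant ?X (q + 1) l" if "l \<in> pg_lines" "vertical_point \<subseteq> l \<and> l \<noteq> line_at_infinity" for l
    using that(1)
  proof (cases rule: pg_lines_cases)
    case (vertical c)
    thus ?thesis
      using that(1) by (simp add: secant_def card_points_on_vertical_line[OF assms])
  qed (use that(2) in auto)
  show "\<exists>n. \<forall>P\<in>points_on pg_points line_at_infinity - {vertical_point}.
      card {l. secant ?X k l \<and> P \<subseteq> l} = n" for k
  proof (intro exI ballI)
    fix P :: "('a ^ 3) set"
    assume "P \<in> points_on pg_points line_at_infinity - {vertical_point}"
    then obtain m where "P = slope_point m"
      by (auto simp: points_on_def del: subsetI elim!: pg_points_cases)
    thus "card {l. secant ?X k l \<and> P \<subseteq> l} =
        card {b. card {x. Q a x = Tr q b} = k} + (if k = 1 then 1 else 0)"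
      using card_secants_through_slope_point[OF assms] by simp
  qed
qed (use assms lines_in_pg_lines in simp_all)

end

theorem theorem1p2:
  fixes q s :: nat and a :: "'a::{finite,field}"
  assumes "primepow q" and "q = s ^ 2"
    and "CARD('a) = q ^ 2" and "a \<noteq> 0"
  shows "card (projective_curve_points (Gamma_poly q s a)) = q ^ 3 + 1 \<and>
    regular_pointed_type q [q + 1 - 2 * s, q + 1 - s, q + 1, q + s + 1]
      (projective_curve_points (Gamma_poly q s a))"
proof -
  interpret gf_biquadratic q s "TYPE('a)"
    by standard fact+
  show ?thesis
    using card_curve[OF assms(4)] regular_pointed_type_curve[OF assms(4)] ..
qed

end
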